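(* Let $R$ be a ring that does not contain any non-trivial idempotent elements. Let $B:=R[X_1,\ldots,X_n]$ be the polynomial ring in $n$ variables over $R$, and $\varphi:B\to B$ an $R$-retraction with image $A$. If $\varphi(X_i)$ is either zero or a monomial for all but at most one $i$, then $A\cong R^{[m]}$, as $R$-algebras, for some $0\le m\le n$.
   Context: All rings are commutative with unity. $R^{[m]}$ denotes the polynomial ring in $m$ variables over $R$. An $R$-retraction $\varphi:B\to B$ is an $R$-algebra homomorphism with $\varphi^2=\varphi$. A monomial of $B$ is a polynomial $\lambda X_1^{a_1}\cdots X_n^{a_n}$ with $0\neq\lambda\in R$ and $a_i$ non-negative integers (nonzero constants are monomials). A non-trivial idempotent is an element $e\in R$ with $e^2=e$ and $e\neq 0,1$. *)

theory Defs
  imports "HOL-Library.Poly_Mapping"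
begin

text \<open>
  An exponent vector is a finitely supported map from variable indices to exponents, and a
  polynomial is a finitely supported map from exponent vectors to coefficients.
  All these polynomials have a fixed supply of variables indexed by the naturals, so that
  polynomial rings in different numbers of variables live in one type.
\<close>

type_synonym 'a mpoly = "(nat \<Rightarrow>\<^sub>0 nat) \<Rightarrow>\<^sub>0 'a"

definition mpoly_const :: "'a::comm_ring_1 \<Rightarrow> 'a mpoly"
  where "mpoly_const c = Poly_Mapping.single 0 c"

definition mpoly_var :: "nat \<Rightarrow> 'a::comm_ring_1 mpoly"
  where "mpoly_var i = Poly_Mapping.single (Poly_Mapping.single i 1) 1"

text \<open>
  The carrier of $R[X_0,\ldots,X_{n-1}]$, where $R$ is the type of coefficients.
\<close>

definition mpoly_ring :: "nat \<Rightarrow> 'a::comm_ring_1 mpoly set"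
  where "mpoly_ring n = {p. \<forall>a \<in> Poly_Mapping.keys p. Poly_Mapping.keys a \<subseteq> {..<n}}"

definition is_monomial :: "nat \<Rightarrow> 'a::comm_ring_1 mpoly \<Rightarrow> bool"
  where "is_monomial n p \<longleftrightarrow>
    (\<exists>c (a :: nat \<Rightarrow> nat). c \<noteq> 0 \<and> p = mpoly_const c * (\<Prod>i<n. mpoly_var i ^ a i))"

text \<open>
  Homomorphisms of $R$-algebras between subalgebras (given by their carriers) of the ambient
  polynomial ring; values of the function outside its domain are irrelevant. Since a subalgebra
  contains the constants, fixing them expresses both $R$-linearity and preservation of $1$.
\<close>

definition alg_hom :: "'a::comm_ring_1 mpoly set \<Rightarrow> 'a mpoly set \<Rightarrow> ('a mpoly \<Rightarrow> 'a mpoly) \<Rightarrow> bool"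
  where "alg_hom A C f \<longleftrightarrow>
    (\<forall>p\<in>A. f p \<in> C) \<and>
    (\<forall>p\<in>A. \<forall>q\<in>A. f (p + q) = f p + f q) \<and>
    (\<forall>p\<in>A. \<forall>q\<in>A. f (p * q) = f p * f q) \<and>
    (\<forall>c. f (mpoly_const c) = mpoly_const c)"

definition alg_retraction :: "'a::comm_ring_1 mpoly set \<Rightarrow> ('a mpoly \<Rightarrow> 'a mpoly) \<Rightarrow> bool"
  where "alg_retraction B f \<longleftrightarrow> alg_hom B B f \<and> (\<forall>p\<in>B. f (f p) = f p)"

definition alg_isomorphic :: "'a::comm_ring_1 mpoly set \<Rightarrow> 'a mpoly set \<Rightarrow> bool"
  where "alg_isomorphic A C \<longleftrightarrow> (\<exists>f. alg_hom A C f \<and> bij_betw f A C)"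

end

theory Submission
  imports Defs
begin

text \<open>
  Let \<open>\<phi>(X\<^sub>i) = c\<^sub>i M\<^sub>i\<close> with power products \<open>M\<^sub>i\<close> for \<open>i \<noteq> j\<close>, and let \<open>I\<close> be the set of those
  \<open>i \<noteq> j\<close> with \<open>c\<^sub>i \<noteq> 0\<close> for which \<open>X\<^sub>i\<close> divides \<open>M\<^sub>i\<close>. For \<open>i \<in> I\<close>, comparing coefficients in
  \<open>\<phi>(\<phi>(X\<^sub>i)) = \<phi>(X\<^sub>i)\<close> shows that \<open>c\<^sub>i\<close> times some element is a nonzero idempotent, so \<open>c\<^sub>i\<close> is a unit;
  then \<open>\<phi>(X\<^sub>i) = X\<^sub>i t\<^sub>i\<close> where \<open>\<phi>(t\<^sub>i) = 1\<close> and \<open>X\<^sub>j\<close> is the only variable in \<open>t\<^sub>i\<close> whose image can be nonconstant.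
  The image of every other variable lies in the subalgebra generated by the \<open>\<phi>(X\<^sub>i)\<close>, \<open>i \<in> V = I \<union> {j}\<close>,
  which yields a retraction of \<open>R[X\<^sub>i | i \<in> V]\<close> with isomorphic image.

  After a translation in the direction of \<open>X\<^sub>j\<close> this retraction preserves the ideal generated by
  the variables, and its linear part is the identity on the \<open>X\<^sub>i\<close>, \<open>i \<in> I\<close>, while the coefficient of
  \<open>X\<^sub>j\<close> in the image of \<open>X\<^sub>j\<close> is idempotent. If that coefficient is \<open>1\<close>, the linear part is the identity,
  hence the retraction is injective (it preserves lowest degree forms), hence the identity. If it is
  \<open>0\<close>, lowest degree forms of elements of the image do not involve \<open>X\<^sub>j\<close>, so setting \<open>X\<^sub>j = 0\<close> maps the image isomorphically onto
  \<open>R[X\<^sub>i | i \<in> I]\<close>.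
\<close>

section \<open>Polynomials in a set of variables\<close>

text \<open>Variable sets are arbitrary because the sets \<open>V\<close> and \<open>W\<close> met
  later need not be initial segments of the naturals.\<close>

definition polys :: "nat set \<Rightarrow> 'a::comm_ring_1 mpoly set"
  where "polys V = {p. \<forall>a\<in>Poly_Mapping.keys p. Poly_Mapping.keys a \<subseteq> V}"

lemma mpoly_ring_eq_polys: "mpoly_ring n = polys {..<n}"
  by (simp add: mpoly_ring_def polys_def)

lemma mpoly_const_0 [simp]: "mpoly_const 0 = 0"
  and mpoly_const_1 [simp]: "mpoly_const 1 = 1"
  and mpoly_const_add: "mpoly_const (c + d) = mpoly_const c + mpoly_const d"
  and mpoly_const_mult: "mpoly_const (c * d) = mpoly_const c * mpoly_const d"
  and mpoly_const_inj [simp]: "mpoly_const c = mpoly_const d \<longleftrightarrow> c = d"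
  by (auto simp: mpoly_const_def single_add mult_single dest: inj_onD[OF inj_single])

lemma mpoly_const_power: "mpoly_const (c ^ k) = mpoly_const c ^ k"
  by (induction k) (simp_all add: mpoly_const_mult)

lemma mpoly_const_prod: "mpoly_const (\<Prod>i\<in>S. f i) = (\<Prod>i\<in>S. mpoly_const (f i))"
  by (induction S rule: infinite_finite_induct) (simp_all add: mpoly_const_mult)

lemma mpoly_var_power: "mpoly_var i ^ k = Poly_Mapping.single (Poly_Mapping.single i k) 1"
  by (induction k) (simp_all add: mpoly_var_def mult_single single_add[symmetric])

lemma prod_mpoly_var_power:
  "(\<Prod>i\<in>S. mpoly_var i ^ a i) = Poly_Mapping.single (\<Sum>i\<in>S. Poly_Mapping.single i (a i)) 1"
  by (induction S rule: infinite_finite_induct) (simp_all add: mpoly_var_power mult_single)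

lemma sum_single_keys:
  assumes "finite S" "Poly_Mapping.keys a \<subseteq> S"
  shows "(\<Sum>i\<in>S. Poly_Mapping.single i (Poly_Mapping.lookup a i)) = a"
proof (rule poly_mapping_eqI)
  fix k
  have "Poly_Mapping.lookup (\<Sum>i\<in>S. Poly_Mapping.single i (Poly_Mapping.lookup a i)) k =
      (\<Sum>i\<in>S. if i = k then Poly_Mapping.lookup a k else 0)"
    unfolding lookup_sum by (rule sum.cong) (auto simp: lookup_single when_def)
  then show "Poly_Mapping.lookup (\<Sum>i\<in>S. Poly_Mapping.single i (Poly_Mapping.lookup a i)) k =
      Poly_Mapping.lookup a k"
    using assms by (auto simp: in_keys_iff)
qed

lemma single_eq_const_mult_prod:
  "Poly_Mapping.single a c =
    mpoly_const c * (\<Prod>i\<in>Poly_Mapping.keys a. mpoly_var i ^ Poly_Mapping.lookup a i)"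
  by (simp add: prod_mpoly_var_power sum_single_keys mpoly_const_def mult_single)

text \<open>Only terms occurring in \<open>p\<close> itself are visited, so facts about the
  exponents of \<open>p\<close>, such as the variables involved or a degree bound, are available for
  each term.\<close>

lemma mpoly_induct_keys:
  fixes p :: "'a::comm_ring_1 mpoly"
  assumes "Q 0" "\<And>p q. Q p \<Longrightarrow> Q q \<Longrightarrow> Q (p + q)"
    and "\<And>a. a \<in> Poly_Mapping.keys p \<Longrightarrow> Q (Poly_Mapping.single a (Poly_Mapping.lookup p a))"
  shows "Q p"
proof -
  have "Q (\<Sum>a\<in>S. Poly_Mapping.single a (Poly_Mapping.lookup p a))"
    if "S \<subseteq> Poly_Mapping.keys p" for S
    using finite_subset[OF that finite_keys] that
    by (induction S rule: finite_induct) (use assms in auto)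
  from this[of "Poly_Mapping.keys p"] show ?thesis
    by (simp add: sum_single_keys)
qed

lemma mpoly_induct [case_names zero add single]:
  fixes p :: "'a::comm_ring_1 mpoly"
  assumes "Q 0" "\<And>p q. Q p \<Longrightarrow> Q q \<Longrightarrow> Q (p + q)" "\<And>a c. Q (Poly_Mapping.single a c)"
  shows "Q p"
  using assms by (rule mpoly_induct_keys)

lemma polys_const [simp]: "mpoly_const c \<in> polys V"
  and polys_0 [simp]: "0 \<in> polys V"
  and polys_1 [simp]: "1 \<in> polys V"
  by (auto simp: polys_def mpoly_const_def)

lemma polys_var [simp]: "i \<in> V \<Longrightarrow> mpoly_var i \<in> polys V"
  by (auto simp: polys_def mpoly_var_def)

lemma polys_add: "p \<in> polys V \<Longrightarrow> q \<in> polys V \<Longrightarrow> p + q \<in> polys V"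
  using keys_add[of p q] by (auto simp: polys_def)

lemma polys_diff: "p \<in> polys V \<Longrightarrow> q \<in> polys V \<Longrightarrow> p - q \<in> polys V"
  using keys_diff[of p q] by (auto simp: polys_def)

lemma polys_mult: "p \<in> polys V \<Longrightarrow> q \<in> polys V \<Longrightarrow> p * q \<in> polys V"
  unfolding polys_def using keys_mult[of p q] keys_add
  by (smt (verit, ccfv_threshold) Un_iff mem_Collect_eq subset_iff)

lemma polys_power: "p \<in> polys V \<Longrightarrow> p ^ k \<in> polys V"
  by (induction k) (simp_all add: polys_mult)

lemma polys_prod: "(\<And>i. i \<in> S \<Longrightarrow> f i \<in> polys V) \<Longrightarrow> (\<Prod>i\<in>S. f i) \<in> polys V"
  by (induction S rule: infinite_finite_induct) (simp_all add: polys_mult)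

lemma polys_sum: "(\<And>i. i \<in> S \<Longrightarrow> f i \<in> polys V) \<Longrightarrow> (\<Sum>i\<in>S. f i) \<in> polys V"
  by (induction S rule: infinite_finite_induct) (simp_all add: polys_add)

lemma polys_mono: "V \<subseteq> W \<Longrightarrow> p \<in> polys V \<Longrightarrow> p \<in> polys W"
  by (auto simp: polys_def)

lemma polys_induct [consumes 1, case_names const var add mult]:
  assumes p: "p \<in> polys V"
    and const: "\<And>c. Q (mpoly_const c)" and var: "\<And>i. i \<in> V \<Longrightarrow> Q (mpoly_var i)"
    and add: "\<And>p q. p \<in> polys V \<Longrightarrow> q \<in> polys V \<Longrightarrow> Q p \<Longrightarrow> Q q \<Longrightarrow> Q (p + q)"
    and mult: "\<And>p q. p \<in> polys V \<Longrightarrow> q \<in> polys V \<Longrightarrow> Q p \<Longrightarrow> Q q \<Longrightarrow> Q (p * q)"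
  shows "Q p"
proof -
  let ?Q = "\<lambda>p. p \<in> polys V \<and> Q p"
  have 1: "?Q 1" using const[of 1] by simp
  have pow: "?Q (mpoly_var i ^ k)" if "i \<in> V" for i k
    by (induction k) (use 1 that var mult in \<open>auto simp: polys_mult polys_power\<close>)
  have prod: "?Q (\<Prod>i\<in>S. mpoly_var i ^ k i)" if "S \<subseteq> V" for S k
    using that by (induction S rule: infinite_finite_induct) (use 1 pow mult in \<open>auto simp: polys_mult\<close>)
  have "?Q p"
  proof (rule mpoly_induct_keys[of ?Q])
    show "?Q 0" using const[of 0] by simp
    show "?Q (p + q)" if "?Q p" "?Q q" for p q using that add by (simp add: polys_add)
    fix a assume "a \<in> Poly_Mapping.keys p"
    then have "Poly_Mapping.keys a \<subseteq> V" using p by (auto simp: polys_def)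
    from prod[OF this] show "?Q (Poly_Mapping.single a (Poly_Mapping.lookup p a))"
      unfolding single_eq_const_mult_prod by (auto simp: polys_mult intro!: mult const)
  qed
  then show ?thesis by simp
qed

text \<open>Makes \<open>polys_induct\<close> applicable to an arbitrary polynomial.\<close>

lemma mpoly_in_polys_UNIV [simp]: "p \<in> polys UNIV"
  by (simp add: polys_def)

text \<open>Exponent vectors cancel, so only one term of \<open>q\<close> can contribute. This
  permits comparing coefficients even when \<open>c\<close> is a zero divisor.\<close>

lemma lookup_single_mult_add:
  fixes q :: "'a::comm_ring_1 mpoly"
  shows "Poly_Mapping.lookup (Poly_Mapping.single b c * q) (b + d) = c * Poly_Mapping.lookup q d"
  by (induction q rule: mpoly_induct)
    (auto simp: lookup_add distrib_left mult_single lookup_single when_def)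

lemma lookup_single_mult_neq_0:
  fixes q :: "'a::comm_ring_1 mpoly"
  assumes "Poly_Mapping.lookup (Poly_Mapping.single b c * q) a \<noteq> 0"
  obtains d where "a = b + d" "c \<noteq> 0"
  using keys_mult[of "Poly_Mapping.single b c" q] assms
  by (auto simp: in_keys_iff[symmetric] split: if_splits)

section \<open>Substitution\<close>

text \<open>The evaluation homomorphism sending each variable \<open>X_i\<close> to
  \<open>g i\<close>. It is total, with infinitely many variables, but on \<open>polys V\<close>
  only the values of \<open>g\<close> on \<open>V\<close> matter.\<close>

definition subst :: "(nat \<Rightarrow> 'a::comm_ring_1 mpoly) \<Rightarrow> 'a mpoly \<Rightarrow> 'a mpoly"
  where "subst g p = (\<Sum>a\<in>Poly_Mapping.keys p. mpoly_const (Poly_Mapping.lookup p a) *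
    (\<Prod>i\<in>Poly_Mapping.keys a. g i ^ Poly_Mapping.lookup a i))"

lemma subst_0 [simp]: "subst g 0 = 0"
  by (simp add: subst_def)

lemma subst_add: "subst g (p + q) = subst g p + subst g q"
  unfolding subst_def
  by (rule setsum_keys_plus_distrib[where f = "\<lambda>a c. mpoly_const c *
    (\<Prod>i\<in>Poly_Mapping.keys a. g i ^ Poly_Mapping.lookup a i)"])
    (auto simp: mpoly_const_add distrib_right)

lemma subst_single:
  "subst g (Poly_Mapping.single a c) =
    mpoly_const c * (\<Prod>i\<in>Poly_Mapping.keys a. g i ^ Poly_Mapping.lookup a i)"
  by (simp add: subst_def)

lemma subst_const [simp]: "subst g (mpoly_const c) = mpoly_const c"
  unfolding mpoly_const_def subst_single by simp

lemma subst_1 [simp]: "subst g 1 = 1"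
  using subst_const[of g 1] by simp

lemma subst_var [simp]: "subst g (mpoly_var i) = g i"
  unfolding mpoly_var_def subst_single by simp

lemma prod_power_keys_superset:
  fixes g :: "nat \<Rightarrow> 'b::comm_monoid_mult"
  assumes "finite S" "Poly_Mapping.keys a \<subseteq> S"
  shows "(\<Prod>i\<in>Poly_Mapping.keys a. g i ^ Poly_Mapping.lookup a i) =
    (\<Prod>i\<in>S. g i ^ Poly_Mapping.lookup a i)"
  by (rule prod.mono_neutral_left) (use assms in \<open>auto simp: in_keys_iff\<close>)

lemma prod_power_keys_add:
  fixes g :: "nat \<Rightarrow> 'b::comm_monoid_mult"
  shows "(\<Prod>i\<in>Poly_Mapping.keys (a + b). g i ^ Poly_Mapping.lookup (a + b) i) =
    (\<Prod>i\<in>Poly_Mapping.keys a. g i ^ Poly_Mapping.lookup a i) *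
    (\<Prod>i\<in>Poly_Mapping.keys b. g i ^ Poly_Mapping.lookup b i)"
proof -
  let ?S = "Poly_Mapping.keys a \<union> Poly_Mapping.keys b"
  show ?thesis
    unfolding prod_power_keys_superset[of ?S "a + b", OF _ keys_add, simplified]
      prod_power_keys_superset[of ?S a, simplified] prod_power_keys_superset[of ?S b, simplified]
    by (simp add: lookup_add power_add prod.distrib)
qed

lemma subst_mult: "subst g (p * q) = subst g p * subst g q"
proof (induction p rule: mpoly_induct)
  case (single a c)
  show ?case
    by (induction q rule: mpoly_induct, simp)
      (simp only: distrib_left subst_add,
        simp add: mult_single subst_single prod_power_keys_add mpoly_const_mult mult_ac)
qed (simp_all add: distrib_right subst_add)

lemma subst_diff: "subst g (p - q) = subst g p - subst g q"
  using subst_add[of g "p - q" q] by (simp add: algebra_simps)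

lemma subst_power: "subst g (p ^ k) = subst g p ^ k"
  by (induction k) (simp_all add: subst_mult)

lemma subst_prod: "subst g (\<Prod>i\<in>S. f i) = (\<Prod>i\<in>S. subst g (f i))"
  by (induction S rule: infinite_finite_induct) (simp_all add: subst_mult)

lemma subst_sum: "subst g (\<Sum>i\<in>S. f i) = (\<Sum>i\<in>S. subst g (f i))"
  by (induction S rule: infinite_finite_induct) (simp_all add: subst_add)

lemmas subst_simps = subst_add subst_diff subst_mult subst_power subst_prod subst_sum

lemma subst_in_polys:
  assumes "p \<in> polys V" "\<And>i. i \<in> V \<Longrightarrow> g i \<in> polys W"
  shows "subst g p \<in> polys W"
  using assms(1) by (induction rule: polys_induct)
    (simp_all add: subst_simps polys_add polys_mult assms(2))

lemma subst_cong:
  assumes "p \<in> polys V" "\<And>i. i \<in> V \<Longrightarrow> g i = h i"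
  shows "subst g p = subst h p"
  using assms(1) by (induction rule: polys_induct) (simp_all add: subst_simps assms(2))

lemma subst_subst: "subst g (subst h p) = subst (\<lambda>i. subst g (h i)) p"
  using mpoly_in_polys_UNIV[of p] by (induction rule: polys_induct) (simp_all add: subst_simps)

lemma subst_id [simp]: "subst mpoly_var p = p"
  using mpoly_in_polys_UNIV[of p] by (induction rule: polys_induct) (simp_all add: subst_simps)

lemma subst_id_on: "p \<in> polys V \<Longrightarrow> (\<And>i. i \<in> V \<Longrightarrow> g i = mpoly_var i) \<Longrightarrow> subst g p = p"
  using subst_cong[of p V g mpoly_var] by simp

text \<open>The constants and the variables generate the algebra, so every homomorphism can be
  handled as a substitution.\<close>

lemma alg_hom_eq_subst:
  assumes "alg_hom (polys V) C f" "p \<in> polys V"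
  shows "f p = subst (\<lambda>i. f (mpoly_var i)) p"
  using assms(2)
  by (induction rule: polys_induct) (use assms(1) in \<open>simp_all add: subst_simps alg_hom_def\<close>)

lemma alg_isomorphicI:
  assumes "bij_betw (subst g) A C"
  shows "alg_isomorphic A C"
  unfolding alg_isomorphic_def alg_hom_def
  using assms bij_betwE[OF assms] by (auto simp: subst_simps intro!: exI[of _ "subst g"])

lemma single_eq_0_iff [simp]: "Poly_Mapping.single i k = 0 \<longleftrightarrow> k = 0"
  by (metis lookup_single_eq lookup_zero single_zero)

section \<open>Constant coefficients as values at the origin\<close>

definition const_coeff :: "'a::comm_ring_1 mpoly \<Rightarrow> 'a"
  where "const_coeff p = Poly_Mapping.lookup p 0"

lemma const_coeff_single: "const_coeff (Poly_Mapping.single a c) = (if a = 0 then c else 0)"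
  by (simp add: const_coeff_def lookup_single when_def)

text \<open>Identifies the constant coefficient with evaluation at the origin, from which it
  inherits multiplicativity.\<close>

lemma subst_zero_eq_const_coeff: "subst (\<lambda>_. 0) p = mpoly_const (const_coeff p)"
proof (induction p rule: mpoly_induct)
  case (single a c)
  have "(\<Prod>i\<in>Poly_Mapping.keys a. 0 ^ Poly_Mapping.lookup a i) = (if a = 0 then 1 else 0 :: 'a mpoly)"
  proof (cases "a = 0")
    case False
    then obtain i where "i \<in> Poly_Mapping.keys a" by (metis all_not_in_conv keys_eq_empty)
    then show ?thesis by (auto simp: in_keys_iff zero_power_eq intro!: prod_zero)
  qed simp
  then show ?case by (auto simp: subst_single const_coeff_single)
qed (simp_all add: subst_add const_coeff_def lookup_add mpoly_const_add)

lemma const_coeff_mult: "const_coeff (p * q) = const_coeff p * const_coeff q"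
proof -
  have "mpoly_const (const_coeff (p * q)) = mpoly_const (const_coeff p * const_coeff q)"
    by (simp flip: subst_zero_eq_const_coeff add: subst_mult mpoly_const_mult)
  then show ?thesis by simp
qed

lemma const_coeff_const [simp]: "const_coeff (mpoly_const c) = c"
  and const_coeff_1 [simp]: "const_coeff 1 = 1"
  and const_coeff_add: "const_coeff (p + q) = const_coeff p + const_coeff q"
  and const_coeff_diff: "const_coeff (p - q) = const_coeff p - const_coeff q"
  and const_coeff_var [simp]: "const_coeff (mpoly_var i) = 0"
  by (simp_all add: const_coeff_def mpoly_const_def mpoly_var_def lookup_add lookup_minus
    lookup_single when_def)

lemma const_coeff_power: "const_coeff (p ^ k) = const_coeff p ^ k"
  by (induction k) (simp_all add: const_coeff_mult)

lemma const_coeff_prod: "const_coeff (\<Prod>i\<in>S. f i) = (\<Prod>i\<in>S. const_coeff (f i))"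
  by (induction S rule: infinite_finite_induct) (simp_all add: const_coeff_mult)

text \<open>The value of a composite at the origin depends only on the values of the
  \<open>g i\<close> there.\<close>

lemma const_coeff_subst:
  "const_coeff (subst g p) = const_coeff (subst (\<lambda>i. mpoly_const (const_coeff (g i))) p)"
  using mpoly_in_polys_UNIV[of p]
  by (induction rule: polys_induct)
    (simp_all add: subst_simps const_coeff_mult const_coeff_add)

section \<open>Order of vanishing at the origin\<close>

definition total_degree :: "(nat \<Rightarrow>\<^sub>0 nat) \<Rightarrow> nat"
  where "total_degree a = (\<Sum>i\<in>Poly_Mapping.keys a. Poly_Mapping.lookup a i)"

lemma total_degree_add: "total_degree (a + b) = total_degree a + total_degree b"
  unfolding total_degree_def by (rule setsum_keys_plus_distrib[where f = "\<lambda>_ x. x"]) auto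

lemma total_degree_single [simp]: "total_degree (Poly_Mapping.single i k) = k"
  by (simp add: total_degree_def)

lemma total_degree_eq_0 [simp]: "total_degree a = 0 \<longleftrightarrow> a = 0"
  by (auto simp: total_degree_def in_keys_iff poly_mapping_eq_iff fun_eq_iff)

lemma total_degree_eq_1:
  assumes "total_degree a = 1"
  obtains i where "i \<in> Poly_Mapping.keys a" "a = Poly_Mapping.single i 1"
proof -
  from assms obtain i where i: "i \<in> Poly_Mapping.keys a"
    by (force simp: total_degree_def)
  have "Poly_Mapping.single i 1 + (a - Poly_Mapping.single i 1) = a"
    using i by (intro poly_mapping_eqI) (auto simp: lookup_add lookup_minus lookup_single when_def in_keys_iff)
  with assms have "a - Poly_Mapping.single i 1 = 0"
    by (metis add_left_cancel add.right_neutral total_degree_add total_degree_eq_0 total_degree_single)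
  with \<open>_ = a\<close> i that show ?thesis by force
qed

text \<open>This is the \<open>d\<close>-th power of the ideal generated by all variables; the
  intersection of these powers is zero.\<close>

definition order_ge :: "nat \<Rightarrow> 'a::comm_ring_1 mpoly set"
  where "order_ge d = {p. \<forall>a\<in>Poly_Mapping.keys p. d \<le> total_degree a}"

lemma order_ge_0 [simp]: "p \<in> order_ge 0"
  and zero_in_order_ge [simp]: "0 \<in> order_ge d"
  by (simp_all add: order_ge_def)

lemma order_ge_add: "p \<in> order_ge d \<Longrightarrow> q \<in> order_ge d \<Longrightarrow> p + q \<in> order_ge d"
  using keys_add[of p q] by (auto simp: order_ge_def)

lemma order_ge_diff: "p \<in> order_ge d \<Longrightarrow> q \<in> order_ge d \<Longrightarrow> p - q \<in> order_ge d"
  using keys_diff[of p q] by (auto simp: order_ge_def)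

lemma order_ge_mult: "p \<in> order_ge d \<Longrightarrow> q \<in> order_ge e \<Longrightarrow> p * q \<in> order_ge (d + e)"
  using keys_mult[of p q] by (fastforce simp: order_ge_def total_degree_add)

lemma order_ge_sum: "(\<And>i. i \<in> S \<Longrightarrow> f i \<in> order_ge d) \<Longrightarrow> (\<Sum>i\<in>S. f i) \<in> order_ge d"
  by (induction S rule: infinite_finite_induct) (simp_all add: order_ge_add)

lemma order_ge_mono: "p \<in> order_ge e \<Longrightarrow> d \<le> e \<Longrightarrow> p \<in> order_ge d"
  by (auto simp: order_ge_def)

lemma order_ge_1_iff: "p \<in> order_ge 1 \<longleftrightarrow> const_coeff p = 0"
proof -
  have "p \<in> order_ge 1 \<longleftrightarrow> (\<forall>a\<in>Poly_Mapping.keys p. a \<noteq> 0)"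
    by (auto simp: order_ge_def Suc_le_eq simp flip: total_degree_eq_0)
  also have "\<dots> \<longleftrightarrow> const_coeff p = 0"
    by (auto simp: const_coeff_def in_keys_iff)
  finally show ?thesis .
qed

lemma order_ge_all:
  assumes "\<And>d. p \<in> order_ge d"
  shows "p = 0"
proof (rule ccontr)
  assume "p \<noteq> 0"
  then obtain a where "a \<in> Poly_Mapping.keys p" by (metis all_not_in_conv keys_eq_empty)
  with assms[of "Suc (total_degree a)"] show False by (fastforce simp: order_ge_def)
qed

lemma order_ge_mult_left: "q \<in> order_ge d \<Longrightarrow> p * q \<in> order_ge d"
  using order_ge_mult[of p 0 q d] by simp

lemma var_in_order_ge: "mpoly_var i \<in> order_ge 1"
  by (simp add: order_ge_1_iff del: One_nat_def)

text \<open>Having order at least \<open>d\<close> and agreeing modulo order \<open>d + 1\<close>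
  means having the same form of degree \<open>d\<close>. This relation is multiplicative because
  \<open>p * p' - q * q' = (p - q) * p' + q * (p' - q')\<close>.\<close>

lemma prod_power_cong_order_ge:
  fixes g h :: "nat \<Rightarrow> 'a::comm_ring_1 mpoly"
  assumes "finite S"
    and g: "\<And>i. i \<in> S \<Longrightarrow> g i \<in> order_ge 1" and h: "\<And>i. i \<in> S \<Longrightarrow> h i \<in> order_ge 1"
    and gh: "\<And>i. i \<in> S \<Longrightarrow> g i - h i \<in> order_ge 2"
  shows "(\<Prod>i\<in>S. g i ^ k i) \<in> order_ge (\<Sum>i\<in>S. k i) \<and> (\<Prod>i\<in>S. h i ^ k i) \<in> order_ge (\<Sum>i\<in>S. k i) \<and>
    (\<Prod>i\<in>S. g i ^ k i) - (\<Prod>i\<in>S. h i ^ k i) \<in> order_ge (Suc (\<Sum>i\<in>S. k i))"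
proof -
  let ?R = "\<lambda>d p (q :: 'a mpoly). p \<in> order_ge d \<and> q \<in> order_ge d \<and> p - q \<in> order_ge (Suc d)"
  have mult: "?R (d + e) (p * p') (q * q')" if 1: "?R d p q" and 2: "?R e p' q'" for d e and p p' q q' :: "'a mpoly"
  proof -
    have "(p - q) * p' \<in> order_ge (Suc (d + e))"
      using order_ge_mult[of "p - q" "Suc d" p' e] that by simp
    moreover have "q * (p' - q') \<in> order_ge (Suc (d + e))"
      using order_ge_mult[of q d "p' - q'" "Suc e"] that by simp
    moreover have "p * p' - q * q' = (p - q) * p' + q * (p' - q')"
      by (simp add: algebra_simps)
    ultimately show ?thesis using that by (auto intro: order_ge_mult order_ge_add)
  qed
  have one: "?R 0 1 1" by simp
  have pow: "?R k (g i ^ k) (h i ^ k)" if "i \<in> S" for i k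
  proof (induction k)
    case (Suc k)
    have "?R 1 (g i) (h i)" using g h gh that by (simp add: numeral_2_eq_2)
    from mult[OF this Suc] show ?case by simp
  qed (use one in simp)
  from \<open>finite S\<close> pow show ?thesis
  proof (induction S rule: finite_induct)
    case (insert x S)
    have "?R (k x + sum k S) (g x ^ k x * (\<Prod>i\<in>S. g i ^ k i)) (h x ^ k x * (\<Prod>i\<in>S. h i ^ k i))"
      by (rule mult) (use insert in auto)
    with insert.hyps show ?case by simp
  qed (use one in simp)
qed

text \<open>The associated graded map only sees the linear parts of the \<open>g i\<close>.\<close>

lemma subst_cong_order_ge:
  assumes p: "p \<in> polys V" "p \<in> order_ge d"
    and g: "\<And>i. i \<in> V \<Longrightarrow> g i \<in> order_ge 1" and h: "\<And>i. i \<in> V \<Longrightarrow> h i \<in> order_ge 1"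
    and gh: "\<And>i. i \<in> V \<Longrightarrow> g i - h i \<in> order_ge 2"
  shows "subst g p \<in> order_ge d" "subst g p - subst h p \<in> order_ge (Suc d)"
proof -
  have "subst g p \<in> order_ge d \<and> subst g p - subst h p \<in> order_ge (Suc d)"
  proof (rule mpoly_induct_keys[where p = p])
    fix p q assume "subst g p \<in> order_ge d \<and> subst g p - subst h p \<in> order_ge (Suc d)"
      "subst g q \<in> order_ge d \<and> subst g q - subst h q \<in> order_ge (Suc d)"
    then show "subst g (p + q) \<in> order_ge d \<and> subst g (p + q) - subst h (p + q) \<in> order_ge (Suc d)"
      using order_ge_add[of "subst g p - subst h p" "Suc d" "subst g q - subst h q"]
      by (auto simp: subst_add algebra_simps intro: order_ge_add)
  next
    fix a assume a: "a \<in> Poly_Mapping.keys p"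
    then have sub: "Poly_Mapping.keys a \<subseteq> V" and d: "d \<le> total_degree a"
      using p by (auto simp: polys_def order_ge_def)
    let ?S = "Poly_Mapping.keys a" and ?k = "Poly_Mapping.lookup a"
    have *: "(\<Prod>i\<in>?S. g i ^ ?k i) \<in> order_ge (\<Sum>i\<in>?S. ?k i) \<and> (\<Prod>i\<in>?S. h i ^ ?k i) \<in> order_ge (\<Sum>i\<in>?S. ?k i) \<and>
      (\<Prod>i\<in>?S. g i ^ ?k i) - (\<Prod>i\<in>?S. h i ^ ?k i) \<in> order_ge (Suc (\<Sum>i\<in>?S. ?k i))"
      by (rule prod_power_cong_order_ge) (use sub g h gh in auto)
    then have "(\<Prod>i\<in>?S. g i ^ ?k i) \<in> order_ge d"
      "(\<Prod>i\<in>?S. g i ^ ?k i) - (\<Prod>i\<in>?S. h i ^ ?k i) \<in> order_ge (Suc d)"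
      using d unfolding total_degree_def[symmetric] by (auto intro: order_ge_mono)
    then show "subst g (Poly_Mapping.single a (Poly_Mapping.lookup p a)) \<in> order_ge d \<and>
        subst g (Poly_Mapping.single a (Poly_Mapping.lookup p a)) -
        subst h (Poly_Mapping.single a (Poly_Mapping.lookup p a)) \<in> order_ge (Suc d)"
      by (auto simp: subst_single order_ge_mult_left simp flip: right_diff_distrib)
  qed simp
  then show "subst g p \<in> order_ge d" "subst g p - subst h p \<in> order_ge (Suc d)" by auto
qed

section \<open>Linear coefficients and linear parts\<close>

definition linear_coeff :: "nat \<Rightarrow> 'a::comm_ring_1 mpoly \<Rightarrow> 'a"
  where "linear_coeff k p = Poly_Mapping.lookup p (Poly_Mapping.single k 1)"

lemma linear_coeff_add: "linear_coeff k (p + q) = linear_coeff k p + linear_coeff k q"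
  and linear_coeff_diff: "linear_coeff k (p - q) = linear_coeff k p - linear_coeff k q"
  and linear_coeff_sum: "linear_coeff k (\<Sum>i\<in>S. f i) = (\<Sum>i\<in>S. linear_coeff k (f i))"
  by (simp_all add: linear_coeff_def lookup_add lookup_minus lookup_sum)

lemma linear_coeff_const_mult: "linear_coeff k (mpoly_const c * p) = c * linear_coeff k p"
  using lookup_single_mult_add[of 0 c p "Poly_Mapping.single k 1"]
  by (simp add: linear_coeff_def mpoly_const_def)

lemma linear_coeff_var: "linear_coeff k (mpoly_var i) = (if i = k then 1 else 0)"
proof -
  have "Poly_Mapping.single i (1::nat) = Poly_Mapping.single k 1 \<longleftrightarrow> i = k"
    by (metis lookup_single_eq lookup_single_not_eq zero_neq_one)
  then show ?thesis by (simp add: linear_coeff_def mpoly_var_def lookup_single when_def)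
qed

lemma linear_coeff_eq_0: "p \<in> order_ge 2 \<Longrightarrow> linear_coeff k p = 0"
  by (force simp: linear_coeff_def order_ge_def in_keys_iff)

lemma linear_coeff_linear:
  "linear_coeff k (\<Sum>i\<in>V. mpoly_const (l i) * mpoly_var i) = (if finite V \<and> k \<in> V then l k else 0)"
  by (cases "finite V")
    (simp_all add: linear_coeff_sum linear_coeff_const_mult linear_coeff_var if_distrib cong: if_cong,
      simp add: linear_coeff_def)

text \<open>An exponent vector of total degree 1 belongs to a single variable, here one in
  \<open>V\<close>, and the subtraction cancels its coefficient.\<close>

lemma diff_linear_part_order_ge:
  assumes "finite V" "p \<in> polys V" "p \<in> order_ge 1"
  shows "p - (\<Sum>i\<in>V. mpoly_const (linear_coeff i p) * mpoly_var i) \<in> order_ge 2"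
proof -
  let ?L = "\<Sum>i\<in>V. mpoly_const (linear_coeff i p) * mpoly_var i"
  let ?q = "p - ?L"
  have q: "?q \<in> polys V"
    using assms by (intro polys_diff polys_sum polys_mult) auto
  have "?L \<in> order_ge 1"
    by (intro order_ge_sum order_ge_mult_left var_in_order_ge)
  then have q1: "?q \<in> order_ge 1" using assms by (intro order_ge_diff)
  have lin: "linear_coeff k ?q = 0" if "k \<in> V" for k
    using that assms(1) by (simp add: linear_coeff_diff linear_coeff_linear)
  have "2 \<le> total_degree a" if a: "a \<in> Poly_Mapping.keys ?q" for a
  proof (rule ccontr)
    assume "\<not> 2 \<le> total_degree a"
    moreover have "1 \<le> total_degree a" using q1 a by (auto simp: order_ge_def)
    ultimately have "total_degree a = 1" by simp
    then obtain k where k: "k \<in> Poly_Mapping.keys a" "a = Poly_Mapping.single k 1"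
      by (rule total_degree_eq_1)
    then have "k \<in> V" using q a by (auto simp: polys_def)
    from lin[OF this] a k show False by (simp add: linear_coeff_def in_keys_iff)
  qed
  then show ?thesis by (simp add: order_ge_def)
qed

section \<open>Retractions with a fixed point\<close>

text \<open>By idempotence \<open>p - subst g p\<close> lies in the kernel, and a map with identity
  linear part has no kernel because it preserves lowest degree forms.\<close>

lemma subst_eq_self_of_linear_part:
  assumes g: "\<And>i. i \<in> V \<Longrightarrow> g i \<in> polys V" and idem: "\<And>i. i \<in> V \<Longrightarrow> subst g (g i) = g i"
    and lin: "\<And>i. i \<in> V \<Longrightarrow> g i - mpoly_var i \<in> order_ge 2"
    and p: "p \<in> polys V"
  shows "subst g p = p"
proof -
  let ?e = "p - subst g p"
  have e: "?e \<in> polys V" using p g by (intro polys_diff subst_in_polys[of _ V])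
  have g1: "g i \<in> order_ge 1" if "i \<in> V" for i
    using order_ge_add[OF order_ge_mono[OF lin[OF that]] var_in_order_ge[of i]] by simp
  have "subst g (subst g p) = subst g p"
    unfolding subst_subst by (rule subst_cong[OF p]) (use idem in auto)
  then have ker: "subst g ?e = 0" by (simp add: subst_diff)
  have "?e \<in> order_ge d" for d
  proof (induction d)
    case (Suc d)
    \<comment> \<open>As \<open>subst g ?e = 0\<close>, this difference is \<open>- ?e\<close>, so
      \<open>?e\<close> gains one order at each step.\<close>
    have "subst g ?e - subst mpoly_var ?e \<in> order_ge (Suc d)"
      by (rule subst_cong_order_ge(2)[OF e Suc]) (use g1 lin var_in_order_ge in auto)
    then show ?case using order_ge_diff[of 0 "Suc d" "- ?e"] by (simp add: ker)
  qed simp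
  then have "?e = 0" by (rule order_ge_all)
  then show ?thesis by simp
qed

text \<open>The linear part of an idempotent map fixing the origin is idempotent, which leaves two
  cases for the coefficient of \<open>X_j\<close> in \<open>g j\<close>. The hypothesis
  \<open>slice\<close> provides surjectivity onto the remaining variables when that coefficient is
  0.\<close>

lemma retraction_fixing_origin:
  fixes g :: "nat \<Rightarrow> 'a::comm_ring_1 mpoly"
  assumes no_idem: "\<not> (\<exists>e::'a. e * e = e \<and> e \<noteq> 0 \<and> e \<noteq> 1)"
    and V: "finite V" "j \<in> V"
    and g: "\<And>i. i \<in> V \<Longrightarrow> g i \<in> polys V" and idem: "\<And>i. i \<in> V \<Longrightarrow> subst g (g i) = g i"
    and lin: "\<And>i. i \<in> V \<Longrightarrow> i \<noteq> j \<Longrightarrow> g i - mpoly_var i \<in> order_ge 2"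
    and slice: "\<And>i. i \<in> V \<Longrightarrow> i \<noteq> j \<Longrightarrow> subst (mpoly_var(j := 0)) (g i) = mpoly_var i"
    and gj: "const_coeff (g j) = 0"
  shows "\<exists>h W. W \<subseteq> V \<and> bij_betw (subst h) (subst g ` polys V) (polys W)"
proof -
  define l where "l i = linear_coeff i (g j)" for i
  \<comment> \<open>\<open>L\<close> is the linear part of \<open>g\<close>: it moves only
    \<open>X_j\<close>, which goes to the linear form of \<open>g j\<close>.\<close>
  define L where "L = mpoly_var(j := (\<Sum>i\<in>V. mpoly_const (l i) * mpoly_var i))"
  have gj1: "g j \<in> order_ge 1" using gj by (simp only: order_ge_1_iff)
  have gL: "g i - L i \<in> order_ge 2" if "i \<in> V" for i
    using diff_linear_part_order_ge[OF V(1) g gj1] lin that by (auto simp: L_def l_def V)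
  have g1: "g i \<in> order_ge 1" if "i \<in> V" for i
  proof (cases "i = j")
    case False
    then show ?thesis
      using order_ge_add[OF order_ge_mono[OF lin[OF that]] var_in_order_ge[of i]] by simp
  qed (use gj1 in simp)
  have L1: "L i \<in> order_ge 1" if "i \<in> V" for i
    using order_ge_diff[OF g1[OF that] order_ge_mono[OF gL[OF that]]] by simp
  have approx: "subst g p - subst L p \<in> order_ge (Suc d)" if "p \<in> polys V" "p \<in> order_ge d" for p d
    using that g1 L1 gL by (rule subst_cong_order_ge(2))
  have fixed: "subst g (subst g p) = subst g p" if "p \<in> polys V" for p
    unfolding subst_subst by (rule subst_cong[OF that]) (use idem in auto)
  have LV: "L j \<in> polys V" by (auto simp: L_def intro!: polys_sum polys_mult)
  \<comment> \<open>Modulo order 2, \<open>L j\<close> agrees with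
    \<open>g j = subst g (g j)\<close>, hence with \<open>subst L (g j)\<close>, hence with
    \<open>subst L (L j)\<close>.\<close>
  have "subst L (L j) - L j \<in> order_ge 2"
  proof -
    have "g j - subst L (g j) \<in> order_ge 2"
      using approx[OF g[OF V(2)] gj1] idem[OF V(2)] by (simp add: numeral_2_eq_2)
    moreover have "subst L (g j - L j) \<in> order_ge 2"
      by (rule subst_cong_order_ge(1)[where V = V and h = L])
        (use g[OF V(2)] LV gL[OF V(2)] L1 in \<open>auto intro: polys_diff\<close>)
    ultimately have "(g j - L j) - (g j - subst L (g j)) - subst L (g j - L j) \<in> order_ge 2"
      using order_ge_diff[OF order_ge_diff[OF gL[OF V(2)]]] by blast
    then show ?thesis by (simp add: subst_diff)
  qed
  from linear_coeff_eq_0[OF this] have "linear_coeff k (subst L (L j)) = linear_coeff k (L j)" for k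
    by (simp add: linear_coeff_diff)
  moreover have Lj: "linear_coeff k (L j) = l k" if "k \<in> V" for k
    using that V by (simp add: L_def linear_coeff_linear)
  moreover have "linear_coeff k (subst L (L j)) = (if k = j then 0 else l k) + l j * l k"
    if "k \<in> V" for k
  proof -
    have "subst L (L j) = (\<Sum>i\<in>V. mpoly_const (l i) * L i)"
      by (simp add: L_def subst_simps)
    also have "\<dots> = (\<Sum>i\<in>V - {j}. mpoly_const (l i) * mpoly_var i) + mpoly_const (l j) * L j"
      using V by (subst sum.remove[of V j]) (simp_all add: L_def add.commute)
    finally show ?thesis
      using that V Lj[OF that]
      by (simp add: linear_coeff_add linear_coeff_linear linear_coeff_const_mult)
  qed
  \<comment> \<open>For \<open>k = j\<close> this is idempotence of \<open>l j\<close>; for other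
    \<open>k\<close> it says \<open>l j * l k = 0\<close>, so \<open>l j = 1\<close> forces
    \<open>l k = 0\<close>.\<close>
  ultimately have l: "(if k = j then 0 else l k) + l j * l k = l k" if "k \<in> V" for k
    using that by metis
  from l[OF V(2)] have "l j * l j = l j" by simp
  with no_idem consider "l j = 1" | "l j = 0" by blast
  then show ?thesis
  proof cases
    case 1
    then have "l k = (if k = j then 1 else 0)" if "k \<in> V" for k
      using l[OF that] by (auto split: if_splits)
    then have "L j = (\<Sum>i\<in>V. if i = j then mpoly_var j else 0)"
      by (auto simp: L_def intro!: sum.cong)
    also have "\<dots> = mpoly_var j" using V by simp
    finally have "g i - mpoly_var i \<in> order_ge 2" if "i \<in> V" for i
      using gL[OF that] by (cases "i = j") (auto simp: L_def)
    from subst_eq_self_of_linear_part[OF g idem this] have "subst g ` polys V = polys V"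
      by (simp cong: image_cong)
    moreover have "bij_betw (subst mpoly_var) (polys V) (polys V)"
      by (simp add: bij_betw_def inj_on_def)
    ultimately show ?thesis by (metis order_refl)
  next
    case 2
    let ?W = "V - {j}" and ?h = "mpoly_var(j := 0) :: nat \<Rightarrow> 'a mpoly"
    have h1: "?h i \<in> order_ge 1" for i
      using var_in_order_ge[of i] by (auto simp del: One_nat_def)
    \<comment> \<open>Since \<open>l j = 0\<close>, the images under \<open>L\<close> do not involve
      \<open>X_j\<close>.\<close>
    have LW: "L i \<in> polys ?W" if "i \<in> V" for i
    proof (cases "i = j")
      case True
      have "L j = (\<Sum>i\<in>?W. mpoly_const (l i) * mpoly_var i)"
        using V 2 by (simp add: L_def sum.remove[of V j])
      then show ?thesis using True by (auto intro!: polys_sum polys_mult)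
    qed (use that in \<open>auto simp: L_def\<close>)
    \<comment> \<open>Injectivity: \<open>p\<close> agrees with \<open>subst L p\<close> to leading
      order. Setting \<open>X_j = 0\<close> kills \<open>p\<close> but fixes
      \<open>subst L p\<close>, so both gain an order.\<close>
    have zero: "p = 0" if "p \<in> polys V" "subst g p = p" "subst ?h p = 0" for p
    proof (rule order_ge_all)
      fix d show "p \<in> order_ge d"
      proof (induction d)
        case (Suc d)
        have 1: "p - subst L p \<in> order_ge (Suc d)"
          using approx[OF that(1) Suc] that(2) by simp
        have LpV: "subst L p \<in> polys V"
          using that(1) LW polys_mono[of ?W V] by (intro subst_in_polys[of p V]) auto
        have "subst ?h (p - subst L p) \<in> order_ge (Suc d)"
          by (rule subst_cong_order_ge(1)[OF polys_diff[OF that(1) LpV] 1, where h = ?h]) (use h1 in simp_all)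
        moreover have "subst ?h (subst L p) = subst L p"
          by (rule subst_id_on[of _ ?W]) (use that(1) LW in \<open>auto intro!: subst_in_polys[of p V]\<close>)
        ultimately have "subst L p \<in> order_ge (Suc d)"
          using that(3) order_ge_diff[of 0 "Suc d" "- subst L p"] by (simp add: subst_diff)
        from order_ge_add[OF 1 this] show ?case by simp
      qed simp
    qed
    have gV: "subst g p \<in> polys V" if "p \<in> polys V" for p
      using that g by (rule subst_in_polys)
    have hW: "?h i \<in> polys ?W" if "i \<in> V" for i using that by auto
    have "bij_betw (subst ?h) (subst g ` polys V) (polys ?W)"
      unfolding bij_betw_def
    proof (intro conjI inj_onI equalityI subsetI)
      fix a b assume ab: "a \<in> subst g ` polys V" "b \<in> subst g ` polys V" "subst ?h a = subst ?h b"
      have "a \<in> polys V" "b \<in> polys V" "subst g a = a" "subst g b = b"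
        using ab gV fixed by fast+
      with ab(3) have "a - b = 0"
        by (intro zero[OF polys_diff]) (simp_all add: subst_diff del: fun_upd_apply)
      then show "a = b" by simp
    next
      fix q assume "q \<in> subst ?h ` (subst g ` polys V)"
      then obtain p where "q = subst ?h (subst g p)" "p \<in> polys V" by blast
      then show "q \<in> polys ?W" using subst_in_polys[OF gV, where g = ?h, OF _ hW] by blast
    next
      fix q assume q: "(q :: 'a mpoly) \<in> polys ?W"
      then have "subst ?h (subst g q) = q"
        unfolding subst_subst by (rule subst_id_on) (use slice in auto)
      moreover have "q \<in> polys V" using q polys_mono[of ?W V q] by auto
      ultimately show "q \<in> subst ?h ` (subst g ` polys V)" by (metis imageI)
    qed
    then show ?thesis by blast
  qed
qed

text \<open>The point with \<open>j\<close>-th coordinate \<open>const_coeff (s j)\<close> and all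
  other coordinates in \<open>V\<close> zero is the image of the origin under the idempotent map on
  points, hence a fixed point. Conjugating by a translation moves it to the origin.\<close>

lemma retraction_fixing_point:
  fixes s t :: "nat \<Rightarrow> 'a::comm_ring_1 mpoly"
  assumes no_idem: "\<not> (\<exists>e::'a. e * e = e \<and> e \<noteq> 0 \<and> e \<noteq> 1)"
    and V: "finite V" "j \<in> V"
    and s: "\<And>i. i \<in> V \<Longrightarrow> s i \<in> polys V" and idem: "\<And>i. i \<in> V \<Longrightarrow> subst s (s i) = s i"
    and st: "\<And>i. i \<in> V \<Longrightarrow> i \<noteq> j \<Longrightarrow> s i = mpoly_var i * t i"
    and t: "\<And>i. i \<in> V \<Longrightarrow> i \<noteq> j \<Longrightarrow>
      subst (mpoly_var(j := mpoly_const (const_coeff (s j)))) (t i) = 1"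
  shows "\<exists>h W. W \<subseteq> V \<and> bij_betw (subst h) (subst s ` polys V) (polys W)"
proof -
  define v where "v = const_coeff (s j)"
  define \<theta> :: "nat \<Rightarrow> 'a mpoly" where "\<theta> = mpoly_var(j := mpoly_var j + mpoly_const v)"
  define \<theta>' :: "nat \<Rightarrow> 'a mpoly" where "\<theta>' = mpoly_var(j := mpoly_var j - mpoly_const v)"
  define g where "g i = subst \<theta> (subst s (\<theta>' i))" for i
  have \<theta>V: "\<theta> i \<in> polys V" "\<theta>' i \<in> polys V" if "i \<in> V" for i
    using that by (auto simp: \<theta>_def \<theta>'_def intro!: polys_add polys_diff)
  have inv: "subst \<theta>' (subst \<theta> p) = p" "subst \<theta> (subst \<theta>' p) = p" for p
    unfolding subst_subst by (rule subst_id_on[of _ UNIV]; simp add: \<theta>_def \<theta>'_def subst_simps)+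
  have g_subst: "subst g p = subst \<theta> (subst s (subst \<theta>' p))" for p
    unfolding subst_subst g_def ..
  have g_ne: "g i = subst \<theta> (s i)" if "i \<noteq> j" for i
    using that by (simp add: g_def \<theta>'_def)
  have fixed: "subst s (subst s p) = subst s p" if "p \<in> polys V" for p
    unfolding subst_subst by (rule subst_cong[OF that]) (use idem in auto)
  have im: "subst g ` polys V = subst \<theta> ` (subst s ` polys V)"
  proof -
    have "subst \<theta>' ` polys V = polys V"
    proof (intro equalityI subsetI)
      fix p :: "'a mpoly" assume "p \<in> polys V"
      then have "subst \<theta> p \<in> polys V" using \<theta>V by (auto intro: subst_in_polys)
      then show "p \<in> subst \<theta>' ` polys V" by (metis inv(1) imageI)
    qed (use \<theta>V in \<open>auto intro: subst_in_polys\<close>)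
    moreover have "subst g ` polys V = subst \<theta> ` (subst s ` (subst \<theta>' ` polys V))"
      by (simp add: g_subst image_image)
    ultimately show ?thesis by simp
  qed
  have "const_coeff (subst \<theta> (s j)) = v"
  proof -
    have "v = const_coeff (subst s (s j))" using idem V by (simp add: v_def)
    also have "\<dots> = const_coeff (subst (\<lambda>i. mpoly_const (const_coeff (s i))) (s j))"
      by (rule const_coeff_subst)
    \<comment> \<open>On \<open>V\<close>, both families have the coordinates of the fixed point as
      constant terms: \<open>s i\<close> is divisible by \<open>X_i\<close> for \<open>i\<close>
      other than \<open>j\<close>.\<close>
    also have "subst (\<lambda>i. mpoly_const (const_coeff (s i))) (s j) =
        subst (\<lambda>i. mpoly_const (const_coeff (\<theta> i))) (s j)"
      by (rule subst_cong[OF s[OF V(2)]])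
        (auto simp: \<theta>_def v_def st const_coeff_mult const_coeff_add)
    also have "const_coeff \<dots> = const_coeff (subst \<theta> (s j))"
      by (rule const_coeff_subst[symmetric])
    finally show ?thesis ..
  qed
  then have gj: "const_coeff (g j) = 0"
    by (simp add: g_def \<theta>'_def subst_diff const_coeff_diff)
  have "\<exists>h W. W \<subseteq> V \<and> bij_betw (subst h) (subst g ` polys V) (polys W)"
  proof (rule retraction_fixing_origin[where j = j and V = V, OF no_idem V])
    show "g i \<in> polys V" if "i \<in> V" for i
      unfolding g_def using that by (intro subst_in_polys[of _ V] \<theta>V s)
    show "subst g (g i) = g i" if "i \<in> V" for i
      unfolding g_subst by (simp add: g_def inv fixed \<theta>V that)
    fix i assume i: "i \<in> V" "i \<noteq> j"
    have gi: "g i = mpoly_var i * subst \<theta> (t i)"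
      using i by (simp add: g_ne st subst_mult) (simp add: \<theta>_def)
    \<comment> \<open>By hypothesis \<open>t i\<close> becomes 1 on the hyperplane where
      \<open>X_j\<close> equals \<open>v\<close>, which contains the fixed point. The value at the
      point gives the linear part, the whole hyperplane gives the slice condition.\<close>
    have "const_coeff (subst \<theta> (t i)) =
        const_coeff (subst (mpoly_var(j := mpoly_const (const_coeff (s j)))) (t i))"
    proof -
      have "(\<lambda>i. mpoly_const (const_coeff (\<theta> i))) = (\<lambda>i. mpoly_const (const_coeff
          ((mpoly_var(j := mpoly_const (const_coeff (s j)))) i)))"
        by (auto simp: \<theta>_def v_def const_coeff_add)
      then show ?thesis by (metis const_coeff_subst)
    qed
    then have "subst \<theta> (t i) - 1 \<in> order_ge 1"
      by (simp add: order_ge_1_iff const_coeff_diff t i del: One_nat_def)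
    from order_ge_mult[OF var_in_order_ge[of i] this]
    show "g i - mpoly_var i \<in> order_ge 2"
      by (simp add: gi algebra_simps numeral_2_eq_2)
    have "subst (mpoly_var(j := 0)) (subst \<theta> (t i)) = 1"
    proof -
      have "(\<lambda>k. subst (mpoly_var(j := 0)) (\<theta> k)) = mpoly_var(j := mpoly_const (const_coeff (s j)))"
        by (auto simp: \<theta>_def v_def subst_add)
      then show ?thesis by (simp add: subst_subst t i)
    qed
    then show "subst (mpoly_var(j := 0)) (g i) = mpoly_var i"
      using i by (simp add: gi subst_mult)
  qed (rule gj)
  then obtain h W where W: "W \<subseteq> V"
    and h: "bij_betw (subst h) (subst \<theta> ` (subst s ` polys V)) (polys W)"
    unfolding im by blast
  have "inj_on (subst \<theta>) (subst s ` polys V)" by (metis inj_onI inv(1))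
  then have "bij_betw (subst \<theta>) (subst s ` polys V) (subst \<theta> ` (subst s ` polys V))"
    by (rule inj_on_imp_bij_betw)
  from bij_betw_trans[OF this h]
  have "bij_betw (subst (\<lambda>i. subst h (\<theta> i))) (subst s ` polys V) (polys W)"
    by (simp add: comp_def subst_subst)
  with W show ?thesis by blast
qed

text \<open>Renumbering the variables in \<open>W\<close> turns them into an initial
  segment.\<close>

lemma alg_isomorphic_mpoly_ring:
  assumes W: "finite W" and h: "bij_betw (subst h) A (polys W)"
  shows "alg_isomorphic A (mpoly_ring (card W))"
proof -
  obtain b where b: "bij_betw b W {..<card W}"
    using ex_bij_betw_finite_nat[OF W] by (auto simp: atLeast0LessThan)
  let ?f = "subst (\<lambda>i. mpoly_var (b i))" and ?g = "subst (\<lambda>i. mpoly_var (inv_into W b i))"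
  have "bij_betw ?f (polys W) (polys {..<card W})"
  proof (rule bij_betw_byWitness[where f' = ?g])
    show "\<forall>p\<in>polys W. ?g (?f p) = p"
      by (auto simp: subst_subst bij_betw_inv_into_left[OF b] intro: subst_id_on)
    show "\<forall>p\<in>polys {..<card W}. ?f (?g p) = p"
      by (auto simp: subst_subst bij_betw_inv_into_right[OF b] intro: subst_id_on)
    show "?f ` polys W \<subseteq> polys {..<card W}"
      using bij_betwE[OF b] by (auto intro!: subst_in_polys[of _ W])
    show "?g ` polys {..<card W} \<subseteq> polys W"
      using bij_betwE[OF bij_betw_inv_into[OF b]] by (auto intro!: subst_in_polys[of _ "{..<card W}"])
  qed
  from bij_betw_trans[OF h this] show ?thesis
    unfolding mpoly_ring_eq_polys by (intro alg_isomorphicI) (simp add: comp_def subst_subst)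
qed

section \<open>Almost monomial retractions\<close>

text \<open>A zero image is covered by \<open>c i = 0\<close>, with no constraint linking
  \<open>E i\<close> to it beyond its variables.\<close>

lemma almost_monomial_retraction:
  fixes g :: "nat \<Rightarrow> 'a::comm_ring_1 mpoly"
  assumes no_idem: "\<not> (\<exists>e::'a. e * e = e \<and> e \<noteq> 0 \<and> e \<noteq> 1)"
    and j: "j < n"
    and g: "\<And>i. i < n \<Longrightarrow> g i \<in> polys {..<n}" and idem: "\<And>i. i < n \<Longrightarrow> subst g (g i) = g i"
    and mono: "\<And>i. i < n \<Longrightarrow> i \<noteq> j \<Longrightarrow> g i = Poly_Mapping.single (E i) (c i)"
    and E: "\<And>i. i < n \<Longrightarrow> i \<noteq> j \<Longrightarrow> Poly_Mapping.keys (E i) \<subseteq> {..<n}"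
  shows "\<exists>h W. W \<subseteq> {..<n} \<and> bij_betw (subst h) (subst g ` polys {..<n}) (polys W)"
proof -
  define e where "e i = Poly_Mapping.lookup (E i)" for i
  have subst_g: "subst h (g i) = mpoly_const (c i) * (\<Prod>k<n. h k ^ e i k)" if "i < n" "i \<noteq> j" for i h
    using that prod_power_keys_superset[of "{..<n}" "E i" h] E[OF that]
    by (simp add: mono subst_single e_def)
  have rel: "g i = mpoly_const (c i) * (\<Prod>k<n. g k ^ e i k)" if "i < n" "i \<noteq> j" for i
    using subst_g[OF that, of g] idem that by simp
  \<comment> \<open>By \<open>rel\<close>, \<open>g k\<close> is a factor of \<open>g i\<close>, so
    the exponent of \<open>g i\<close> is that of \<open>g k\<close> plus another exponent.\<close>
  have divisor: "c k \<noteq> 0 \<and> (\<exists>d. E i = E k + d)"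
    if i: "i < n" "i \<noteq> j" "c i \<noteq> 0" and k: "k < n" "k \<noteq> j" "e i k > 0" for i k
  proof -
    have "g k dvd (\<Prod>k<n. g k ^ e i k)"
      using k by (intro dvd_trans[OF _ dvd_prodI[of _ k]]) (auto intro: dvd_power)
    then have "g k dvd g i" using rel[OF i(1,2)] by (metis dvd_mult)
    then obtain q where "g i = g k * q" ..
    then have "Poly_Mapping.lookup (Poly_Mapping.single (E k) (c k) * q) (E i) \<noteq> 0"
      using mono i k by (metis lookup_single_eq)
    then show ?thesis by (rule lookup_single_mult_neq_0) blast
  qed

  have unit: "e i i = 1 \<and> mpoly_const (c i) * (\<Prod>k\<in>{..<n} - {i}. g k ^ e i k) = 1"
    if i: "i < n" "i \<noteq> j" "c i \<noteq> 0" "e i i > 0" for i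
  proof -
    \<comment> \<open>\<open>P\<close> is the product in \<open>rel\<close> with one factor
      \<open>g i\<close> removed, so that \<open>g i * Q = g i\<close>.\<close>
    define P where "P = g i ^ (e i i - 1) * (\<Prod>k\<in>{..<n} - {i}. g k ^ e i k)"
    define Q where "Q = mpoly_const (c i) * P"
    have "(\<Prod>k<n. g k ^ e i k) = g i * P"
      using i power_minus_mult[of "e i i" "g i"]
      by (simp add: prod.remove[of "{..<n}" i] P_def mult.commute[of _ "g i"] flip: mult.assoc)
    then have "Poly_Mapping.single (E i) (c i) * Q = Poly_Mapping.single (E i) (c i)"
      using rel[of i] mono[of i] i by (simp add: Q_def mult_ac)
    then have cQ: "c i * Poly_Mapping.lookup Q d = (if d = 0 then c i else 0)" for d
      using lookup_single_mult_add[of "E i" "c i" Q d] by (simp add: lookup_single when_def)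
    define w where "w = const_coeff P"
    have "c i * (c i * w) = c i"
      using cQ[of 0] by (simp add: Q_def w_def const_coeff_mult flip: const_coeff_def)
    \<comment> \<open>The idempotent \<open>c i * w\<close> is nonzero because multiplying it by
      \<open>c i\<close> gives \<open>c i\<close>. Hence \<open>w\<close> is an inverse of
      \<open>c i\<close>, and \<open>cQ\<close> determines all coefficients of
      \<open>Q\<close>.\<close>
    then have "(c i * w) * (c i * w) = c i * w" "c i * w \<noteq> 0"
      using i by (metis mult.assoc mult.commute, metis mult_zero_right)
    with no_idem have w: "c i * w = 1" by blast
    have "Q = 1"
    proof (rule poly_mapping_eqI)
      fix d
      have "Poly_Mapping.lookup Q d = w * (c i * Poly_Mapping.lookup Q d)"
        using w by (metis mult.assoc mult.commute mult_1)
      then show "Poly_Mapping.lookup Q d = Poly_Mapping.lookup 1 d"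
        using w by (simp add: cQ lookup_one mult.commute)
    qed
    moreover have "const_coeff (g i) = 0"
      using i mono by (auto simp: const_coeff_single e_def)
    \<comment> \<open>Otherwise \<open>P\<close> retains a factor \<open>g i\<close>, whose constant
      coefficient is 0, although \<open>w\<close> is a unit.\<close>
    ultimately have "e i i - 1 = 0"
      using w by (cases "e i i - 1 = 0")
        (auto simp: w_def P_def const_coeff_mult const_coeff_power zero_power)
    with i \<open>Q = 1\<close> show ?thesis by (auto simp: Q_def P_def)
  qed
  have const: "E k = 0"
    if i: "i < n" "i \<noteq> j" "c i \<noteq> 0" "e i i > 0" and k: "k < n" "k \<noteq> i" "k \<noteq> j" "e i k > 0" for i k
  proof -
    \<comment> \<open>By \<open>unit\<close>, such a \<open>g k\<close> divides 1, and a single term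
      dividing 1 has exponent vector 0.\<close>
    have "g k dvd (\<Prod>k\<in>{..<n} - {i}. g k ^ e i k)"
      using k by (intro dvd_trans[OF _ dvd_prodI[of _ k]]) (auto intro: dvd_power)
    then have "g k dvd 1" using unit[OF i] by (metis dvd_mult)
    then obtain q where "1 = Poly_Mapping.single (E k) (c k) * q" using mono k by (auto elim: dvdE)
    then have "Poly_Mapping.lookup (Poly_Mapping.single (E k) (c k) * q) 0 \<noteq> 0"
      by (metis lookup_one_zero zero_neq_one)
    then obtain d where "0 = E k + d" by (rule lookup_single_mult_neq_0)
    then have "total_degree (E k) + total_degree d = 0"
      by (metis total_degree_add total_degree_eq_0)
    then show ?thesis by simp
  qed

  define V where "V = {i. i < n \<and> (i = j \<or> c i \<noteq> 0 \<and> e i i > 0)}"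
  have V: "finite V" "j \<in> V" "V \<subseteq> {..<n}" using j by (auto simp: V_def)
  \<comment> \<open>Induction on the degree of the image: outside \<open>V\<close>,
    \<open>rel\<close> rewrites \<open>g i\<close> through images \<open>g k\<close> with
    \<open>k\<close> in \<open>V\<close> or of smaller degree.\<close>
  have gen: "\<exists>r\<in>polys V. subst g r = g i" if "i < n" for i
    using that
  proof (induction "total_degree (E i)" arbitrary: i rule: less_induct)
    case less
    consider "i \<in> V" | "i \<noteq> j" "c i = 0" | "i \<noteq> j" "c i \<noteq> 0" "e i i = 0"
      using less.prems by (auto simp: V_def)
    then show ?case
    proof cases
      case 1
      then show ?thesis by (intro bexI[of _ "mpoly_var i"]) auto
    next
      case 2
      then show ?thesis using less.prems mono by (intro bexI[of _ 0]) auto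
    next
      case 3
      have "\<exists>r\<in>polys V. subst g r = g k" if k: "k \<in> Poly_Mapping.keys (E i)" for k
      proof (cases "k \<in> V")
        case False
        have kn: "k < n" "k \<noteq> j" "e i k > 0"
          using k subsetD[OF E[OF less.prems 3(1)] k] False V by (auto simp: e_def in_keys_iff)
        from divisor[OF less.prems 3(1,2) this] obtain d where d: "c k \<noteq> 0" "E i = E k + d" by blast
        with False kn have "e k k = 0" by (auto simp: V_def)
        \<comment> \<open>The variable \<open>X_k\<close> occurs in \<open>E i\<close> but not in
          \<open>E k\<close>.\<close>
        with d kn have "d \<noteq> 0" by (auto simp: e_def)
        with d have "total_degree (E k) < total_degree (E i)"
          by (simp add: total_degree_add) (simp flip: total_degree_eq_0)
        then show ?thesis using less.hyps kn by blast
      qed (auto intro: bexI[of _ "mpoly_var k"])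
      then obtain r where r: "r k \<in> polys V" "subst g (r k) = g k"
        if "k \<in> Poly_Mapping.keys (E i)" for k by metis
      let ?r = "mpoly_const (c i) * (\<Prod>k\<in>Poly_Mapping.keys (E i). r k ^ Poly_Mapping.lookup (E i) k)"
      have "subst g ?r = subst g (g i)"
        using less.prems 3 mono r by (simp add: subst_single subst_simps cong: prod.cong)
      moreover have "?r \<in> polys V" using r by (auto intro!: polys_mult polys_prod polys_power)
      ultimately show ?thesis using idem less.prems by metis
    qed
  qed
  \<comment> \<open>The preimages are normalised: variables in \<open>V\<close> represent
    themselves, and constant images outside \<open>V\<close> are represented by constants. This
    keeps the factors of \<open>t i\<close> computable.\<close>
  have "\<exists>r\<in>polys V. subst g r = g i \<and> (i \<in> V \<longrightarrow> r = mpoly_var i) \<and>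
      (i \<notin> V \<longrightarrow> E i = 0 \<longrightarrow> r = mpoly_const (c i))" if "i < n" for i
  proof (cases "i \<in> V \<or> E i \<noteq> 0")
    case True
    then show ?thesis using gen[OF that] by (cases "i \<in> V") auto
  next
    case False
    then have "g i = mpoly_const (c i)" using mono[OF that] V by (auto simp: mpoly_const_def)
    with False show ?thesis by (intro bexI[of _ "mpoly_const (c i)"]) auto
  qed
  then obtain r where r: "r i \<in> polys V" "subst g (r i) = g i"
    and r_var: "i \<in> V \<Longrightarrow> r i = mpoly_var i"
    and r_const: "i \<notin> V \<Longrightarrow> E i = 0 \<Longrightarrow> r i = mpoly_const (c i)" if "i < n" for i
    by metis
  \<comment> \<open>This is \<open>g\<close> transported to \<open>polys V\<close>: since
    \<open>g\<close> after \<open>r\<close> equals \<open>g\<close> on polynomials in the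
    \<open>n\<close> variables, \<open>s\<close> inherits idempotence.\<close>
  define s where "s i = subst r (g i)" for i
  have s_subst: "subst s p = subst r (subst g p)" for p
    unfolding subst_subst s_def ..
  have gr: "subst g (subst r p) = subst g p" if "p \<in> polys {..<n}" for p
    unfolding subst_subst by (rule subst_cong[OF that]) (use r in auto)
  have gg: "subst g (subst g p) = subst g p" if "p \<in> polys {..<n}" for p
    unfolding subst_subst by (rule subst_cong[OF that]) (use idem in auto)
  have g_in: "subst g p \<in> polys {..<n}" if "p \<in> polys {..<n}" for p
    using that g by (auto intro: subst_in_polys)
  have r_in: "subst r p \<in> polys V" if "p \<in> polys {..<n}" for p
    using that r by (auto intro: subst_in_polys)
  have V_in: "p \<in> polys {..<n}" if "p \<in> polys V" for p
    using that V by (auto intro: polys_mono)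
  define t where "t i = mpoly_const (c i) * (\<Prod>k\<in>{..<n} - {i}. r k ^ e i k)" for i
  have "\<exists>h W. W \<subseteq> V \<and> bij_betw (subst h) (subst s ` polys V) (polys W)"
  proof (rule retraction_fixing_point[where j = j and t = t, OF no_idem V(1,2)])
    show "s i \<in> polys V" if "i \<in> V" for i
      using that V g r_in by (auto simp: s_def)
    show "subst s (s i) = s i" if "i \<in> V" for i
      using that V g idem by (auto simp: s_subst s_def gr)
    fix i assume "i \<in> V" "i \<noteq> j"
    then have i: "i < n" "i \<noteq> j" "c i \<noteq> 0" "e i i > 0" by (auto simp: V_def)
    show "s i = mpoly_var i * t i"
      using i unit[OF i] \<open>i \<in> V\<close>
      by (simp add: s_def subst_g t_def prod.remove[of "{..<n}" i] r_var mult_ac)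
    let ?\<pi> = "subst (mpoly_var(j := mpoly_const (const_coeff (s j))))"
    \<comment> \<open>Factors of \<open>t i\<close> with positive exponent are \<open>X_j\<close>,
      which \<open>?\<pi>\<close> evaluates, or constants by \<open>const\<close>. Each becomes the
      constant coefficient of \<open>s k\<close>, so applying \<open>r\<close> to the relation in
      \<open>unit\<close> gives the value 1.\<close>
    have "?\<pi> (r k) ^ e i k = mpoly_const (const_coeff (s k) ^ e i k)" if k: "k \<in> {..<n} - {i}" for k
    proof -
      consider "e i k = 0" | "k = j" | "k \<noteq> j" "e i k > 0" by auto
      then show ?thesis
      proof cases
        case 2
        then show ?thesis using V r_var[of j] j by (simp add: mpoly_const_power)
      next
        case 3
        with const[OF i] k have Ek: "E k = 0" by auto
        then have "k \<notin> V" using 3 by (auto simp: V_def e_def)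
        then have "r k = mpoly_const (c k)" using r_const Ek k by auto
        moreover have "g k = mpoly_const (c k)"
          using mono[of k] k 3 Ek by (auto simp: mpoly_const_def)
        ultimately show ?thesis by (simp add: s_def mpoly_const_power)
      qed simp
    qed
    then have "(\<Prod>k\<in>{..<n} - {i}. ?\<pi> (r k) ^ e i k) =
        (\<Prod>k\<in>{..<n} - {i}. mpoly_const (const_coeff (s k) ^ e i k))"
      by (rule prod.cong[OF refl])
    then have "?\<pi> (t i) = mpoly_const (c i * (\<Prod>k\<in>{..<n} - {i}. const_coeff (s k) ^ e i k))"
      by (simp only: t_def subst_simps subst_const mpoly_const_mult mpoly_const_prod)
    also have "c i * (\<Prod>k\<in>{..<n} - {i}. const_coeff (s k) ^ e i k) =
        const_coeff (subst r (mpoly_const (c i) * (\<Prod>k\<in>{..<n} - {i}. g k ^ e i k)))"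
      by (simp add: subst_simps const_coeff_mult const_coeff_prod const_coeff_power s_def)
    also have "\<dots> = 1" using unit[OF i] by simp
    finally show "?\<pi> (t i) = 1" by (simp only: mpoly_const_1)
  qed
  then obtain h W where W: "W \<subseteq> V" and h: "bij_betw (subst h) (subst s ` polys V) (polys W)"
    by blast
  have "bij_betw (subst r) (subst g ` polys {..<n}) (subst s ` polys V)"
  \<comment> \<open>\<open>subst r\<close> and \<open>subst g\<close> are mutually inverse between
    the two images.\<close>
  proof (rule bij_betw_byWitness[where f' = "subst g"])
    show "\<forall>a\<in>subst g ` polys {..<n}. subst g (subst r a) = a"
      by (auto simp: gr gg g_in)
    show "\<forall>b\<in>subst s ` polys V. subst r (subst g b) = b"
      by (auto simp: s_subst gr gg g_in V_in)
    show "subst r ` (subst g ` polys {..<n}) \<subseteq> subst s ` polys V"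
    proof clarify
      fix p :: "'a mpoly" assume p: "p \<in> polys {..<n}"
      then have "subst r (subst g p) = subst s (subst r p)" by (simp add: s_subst gr)
      then show "subst r (subst g p) \<in> subst s ` polys V" using r_in[OF p] by simp
    qed
    show "subst g ` (subst s ` polys V) \<subseteq> subst g ` polys {..<n}"
      by (auto simp: s_subst gr gg g_in V_in)
  qed
  from bij_betw_trans[OF this h]
  have "bij_betw (subst (\<lambda>i. subst h (r i))) (subst g ` polys {..<n}) (polys W)"
    by (simp add: comp_def subst_subst)
  with W V show ?thesis by blast
qed

theorem proposition5p1:
  fixes n :: nat
    and \<phi> :: "'a::comm_ring_1 mpoly \<Rightarrow> 'a mpoly"
    and A :: "'a mpoly set"
  assumes no_idem: "\<not> (\<exists>e::'a. e * e = e \<and> e \<noteq> 0 \<and> e \<noteq> 1)"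
    and retr: "alg_retraction (mpoly_ring n) \<phi>"
    and image: "A = \<phi> ` mpoly_ring n"
    and mono: "\<exists>j. \<forall>i<n. i \<noteq> j \<longrightarrow>
      \<phi> (mpoly_var i) = 0 \<or> is_monomial n (\<phi> (mpoly_var i))"
  shows "\<exists>m\<le>n. alg_isomorphic A (mpoly_ring m)"
proof -
  define g where "g i = \<phi> (mpoly_var i)" for i
  have hom: "alg_hom (polys {..<n}) (polys {..<n}) \<phi>"
    using retr by (simp add: alg_retraction_def mpoly_ring_eq_polys)
  have retract: "\<phi> (\<phi> p) = \<phi> p" if "p \<in> polys {..<n}" for p
    using retr that by (simp add: alg_retraction_def mpoly_ring_eq_polys)
  have \<phi>: "\<phi> p = subst g p" if "p \<in> polys {..<n}" for p
    unfolding g_def by (rule alg_hom_eq_subst[OF hom that]; simp)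
  have g: "g i \<in> polys {..<n}" if "i < n" for i
    using hom that unfolding alg_hom_def g_def by simp
  have idem: "subst g (g i) = g i" if "i < n" for i
    using retract[of "mpoly_var i"] \<phi>[OF g] that by (simp add: g_def)
  have A: "A = subst g ` polys {..<n}"
    using \<phi> by (auto simp: image mpoly_ring_eq_polys)
  have "\<exists>h W. W \<subseteq> {..<n} \<and> bij_betw (subst h) A (polys W)"
  \<comment> \<open>With no variables there is no index to serve as \<open>j\<close>; the image is
    then the ring of constants.\<close>
  proof (cases "n = 0")
    case True
    have "subst g p = p" if "p \<in> polys {}" for p
      using that by (rule subst_id_on) simp
    then have "A = polys {..<n}" by (simp add: A True)
    then have "bij_betw (subst mpoly_var) A (polys {..<n})"
      by (simp add: bij_betw_def inj_on_def)
    then show ?thesis by blast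
  next
    case False
    obtain j where j: "j < n"
      and mono_j: "\<And>i. i < n \<Longrightarrow> i \<noteq> j \<Longrightarrow> g i = 0 \<or> is_monomial n (g i)"
    proof -
      from mono obtain j where "\<forall>i<n. i \<noteq> j \<longrightarrow> g i = 0 \<or> is_monomial n (g i)"
        by (auto simp: g_def)
      \<comment> \<open>An exceptional index outside the range excludes nothing, so 0 may replace
        it.\<close>
      then show ?thesis using that[of "if j < n then j else 0"] False by (auto split: if_splits)
    qed
    have "\<exists>a c. g i = Poly_Mapping.single a c \<and> Poly_Mapping.keys a \<subseteq> {..<n}"
      if "i < n" "i \<noteq> j" for i
      using mono_j[OF that]
    proof
      assume "g i = 0"
      then have "g i = Poly_Mapping.single 0 0" by simp
      then show ?thesis by (metis empty_subsetI keys_zero)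
    next
      assume "is_monomial n (g i)"
      then obtain c a where "g i = mpoly_const c * (\<Prod>i<n. mpoly_var i ^ a i)"
        by (auto simp: is_monomial_def)
      then have "g i = Poly_Mapping.single (\<Sum>i<n. Poly_Mapping.single i (a i)) c"
        by (simp add: prod_mpoly_var_power mpoly_const_def mult_single)
      moreover have "Poly_Mapping.keys (\<Sum>i<n. Poly_Mapping.single i (a i)) \<subseteq> {..<n}"
        using keys_sum[of "\<lambda>i. Poly_Mapping.single i (a i)" "{..<n}"] by (force split: if_splits)
      ultimately show ?thesis by blast
    qed
    then obtain E c where "g i = Poly_Mapping.single (E i) (c i)" "Poly_Mapping.keys (E i) \<subseteq> {..<n}"
      if "i < n" "i \<noteq> j" for i by metis
    from almost_monomial_retraction[OF no_idem j g idem this] show ?thesis unfolding A .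
  qed
  then obtain h W where W: "W \<subseteq> {..<n}" and h: "bij_betw (subst h) A (polys W)" by blast
  from alg_isomorphic_mpoly_ring[OF finite_subset[OF W] h] card_mono[OF _ W]
  show ?thesis by auto
qed

end
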